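(* Let $m\ge 4$ be even, $n=2^m$, let $K$ be a Kerdock code of length $n$, and let $K''$ be a doubly shortened Kerdock code, of length $n-2$, obtained from $K$. Then the restriction of the Hamming scheme to $K''$ is an association scheme.
   Context: A binary code of length $N$ is a subset of $GF(2)^N$; $d(x,y)$ denotes Hamming distance. Kerdock code: for even $m\ge 4$ and $n=2^m$, a Kerdock code $K$ is a binary code of length $n$ and minimum distance $d=(n-\sqrt n)/2$ which is the union of the first order Reed–Muller code $\mathrm{RM}(1,m)$ and $2^{m-1}-1$ further (distinct) cosets of $\mathrm{RM}(1,m)$, such that all codewords in each of these further cosets have weight $d$ or $n-d$. Shortening: the shortened code of $C$ at a coordinate position is obtained by taking all codewords of $C$ having zero at that position and deleting this position. The doubly shortened code $K''$ is obtained by shortening twice, i.e. at two distinct positions of $K$. Association scheme: a pair $(X,\{R_i\}_{i\in I})$, where the relations $R_i$, $i\in I$, partition $X\times X$, is an association scheme if (1) $\{(x,x):x\in X\}$ is $R_j$ for some $j\in I$; (2) for every $i\in I$ the relation $R_i^{-1}=\{(y,x):(x,y)\in R_i\}$ is $R_j$ for some $j\in I$; (3) for all $i,j,k\in I$ there is a number $\delta_{i,j}^k(X)$ such that for every $(x,y)\in R_i$ one has $|\{z\in X:(x,z)\in R_j,\ (y,z)\in R_k\}|=\delta_{i,j}^k(X)$. Restriction of the Hamming scheme to a code $C$: the pair $(C,\{R_i\}_{i\in I(C)})$ with $I(C)=\{d(x,y):x,y\in C\}$ and $R_i=\{(x,y)\in C\times C: d(x,y)=i\}$. *)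

theory Defs
  imports Complex_Main "HOL-Library.Z2" "HOL-Library.Disjoint_Sets"
begin

(* GF(2) is the two-element field type bit of HOL-Library.Z2; the vectors of GF(2)^N are the
   lists over it of length N, so that deleting a coordinate really lowers the length. *)
type_synonym word = "bit list"

definition binary_code :: "nat \<Rightarrow> word set \<Rightarrow> bool" where
  "binary_code N C \<longleftrightarrow> C \<subseteq> {x. length x = N}"

(* Only meaningful for words of equal length. *)
definition hamming_dist :: "word \<Rightarrow> word \<Rightarrow> nat" where
  "hamming_dist x y = card {i. i < length x \<and> x ! i \<noteq> y ! i}"

definition hamming_weight :: "word \<Rightarrow> nat" where
  "hamming_weight x = card {i. i < length x \<and> x ! i \<noteq> 0}"

(* Only meaningful for codes of a fixed length with at least two words. *)
definition min_distance :: "word set \<Rightarrow> nat" where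
  "min_distance C = Min {hamming_dist x y | x y. x \<in> C \<and> y \<in> C \<and> x \<noteq> y}"

(* RM(1,m): value tables of the polynomials c + a_0 v_0 + ... + a_(m-1) v_(m-1) over GF(2).
   Coordinate j < 2^m stands for the point of GF(2)^m whose entries are the binary digits of j
   (the function bit in the formula extracts a binary digit; the type bit is GF(2)). *)
definition RM1 :: "nat \<Rightarrow> word set" where
  "RM1 m = {map (\<lambda>j. c + (\<Sum>i<m. a i * of_bool (bit j i))) [0..<2 ^ m] |
              (c :: bit) (a :: nat \<Rightarrow> bit). True}"

definition coset :: "word \<Rightarrow> word set \<Rightarrow> word set" where
  "coset u C = {map2 (+) u x | x. x \<in> C}"

definition kerdock_code :: "nat \<Rightarrow> word set \<Rightarrow> bool" where
  "kerdock_code m K \<longleftrightarrow>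
     (let n = 2 ^ m; d = (real n - sqrt (real n)) / 2 in
        binary_code n K \<and>
        real (min_distance K) = d \<and>
        (\<exists>\<C>. K = RM1 m \<union> \<Union>\<C> \<and>
             finite \<C> \<and> card \<C> = 2 ^ (m - 1) - 1 \<and>
             (\<forall>A\<in>\<C>. (\<exists>u. length u = n \<and> A = coset u (RM1 m)) \<and> A \<noteq> RM1 m \<and>
                (\<forall>x\<in>A. real (hamming_weight x) = d \<or> real (hamming_weight x) = real n - d))))"

definition delete_pos :: "nat \<Rightarrow> 'a list \<Rightarrow> 'a list" where
  "delete_pos p x = take p x @ drop (Suc p) x"

definition shorten :: "nat \<Rightarrow> word set \<Rightarrow> word set" where
  "shorten p C = delete_pos p ` {x \<in> C. x ! p = 0}"

(* The second position q refers to the words of length N - 1 left after the first shortening;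
   it therefore ranges over all positions of the original words other than p. *)
definition doubly_shortened :: "nat \<Rightarrow> word set \<Rightarrow> word set \<Rightarrow> bool" where
  "doubly_shortened N C D \<longleftrightarrow> (\<exists>p q. p < N \<and> q < N - 1 \<and> D = shorten q (shorten p C))"

(* A partition into an indexed family: nonempty, pairwise disjoint classes.  Finiteness of the
   counted sets is stated because card is 0 on infinite sets. *)
definition association_scheme :: "'a set \<Rightarrow> 'i set \<Rightarrow> ('i \<Rightarrow> ('a \<times> 'a) set) \<Rightarrow> bool" where
  "association_scheme X I R \<longleftrightarrow>
     (\<Union>i\<in>I. R i) = X \<times> X \<and> disjoint_family_on R I \<and> (\<forall>i\<in>I. R i \<noteq> {}) \<and>
     (\<exists>j\<in>I. Id_on X = R j) \<and>
     (\<forall>i\<in>I. \<exists>j\<in>I. (R i)\<inverse> = R j) \<and>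
     (\<forall>i\<in>I. \<forall>j\<in>I. \<forall>k\<in>I. \<exists>\<delta>::nat. \<forall>(x, y)\<in>R i.
        finite {z \<in> X. (x, z) \<in> R j \<and> (y, z) \<in> R k} \<and>
        card {z \<in> X. (x, z) \<in> R j \<and> (y, z) \<in> R k} = \<delta>)"

definition distances :: "word set \<Rightarrow> nat set" where
  "distances C = {hamming_dist x y | x y. x \<in> C \<and> y \<in> C}"

definition hamming_rel :: "word set \<Rightarrow> nat \<Rightarrow> (word \<times> word) set" where
  "hamming_rel C i = {(x, y). x \<in> C \<and> y \<in> C \<and> hamming_dist x y = i}"

end

theory Submission
  imports Defs
begin

text \<open>
  Write words as vectors of signs and let \<open>corr x y = n - 2 d(x, y)\<close> be their inner product.
  Parseval's identity on a coset of the first order Reed-Muller code forces \<open>(corr x y)\<^sup>2 = n\<close>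
  for codewords in different cosets.  The fourth moment of \<open>corr\<close> over pairs of codewords then
  equals that of the whole Hamming space.  That moment is a sum of squares of character sums over
  \<open>K\<close>, so all nontrivial character sums of order four vanish; those of odd order vanish because
  \<open>K\<close> is closed under complements.

  Hence, for \<open>x, y\<close> in the twice shortened code, the moments \<open>\<Sum>\<^sub>z (corr x z)\<^sup>a (corr y z)\<^sup>b\<close> with
  \<open>a + b \<le> 3\<close> depend on \<open>d(x, y)\<close> only.  As \<open>corr\<close> takes only three values on distinct words, the
  intersection numbers are determined by the moments with \<open>a, b \<le> 2\<close>.  The remaining moment
  \<open>a = b = 2\<close> is beyond the strength of the code as an orthogonal array; it is recovered from the
  others because \<open>corr x y = 0\<close> holds, for \<open>x \<noteq> y\<close>, exactly within the cosets, and lying in a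
  common coset is an equivalence relation.
\<close>

section \<open>Words as sign vectors\<close>

text \<open>\<open>sg\<close> is the nontrivial additive character of GF(2), so sums of products of
  signs are character sums.\<close>

definition sg :: "bit \<Rightarrow> real" where
  "sg b = (if b = 0 then 1 else -1)"

lemma sg_0 [simp]: "sg 0 = 1" and sg_1 [simp]: "sg 1 = -1"
  by (simp_all add: sg_def)

lemma sg_add: "sg (a + b) = sg a * sg b"
  by (cases a; cases b) (simp_all add: sg_def)

lemma sg_mult_self [simp]: "sg a * sg a = 1"
  by (simp add: sg_def)

lemma sg_mult: "sg a * sg b = 1 - 2 * of_bool (a \<noteq> b)"
  by (cases a; cases b) simp_all

definition vadd :: "word \<Rightarrow> word \<Rightarrow> word" where
  "vadd = map2 (+)"

lemma length_vadd [simp]: "length (vadd x y) = min (length x) (length y)"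
  by (simp add: vadd_def)

lemma nth_vadd: "p < length x \<Longrightarrow> length x = length y \<Longrightarrow> vadd x y ! p = x ! p + y ! p"
  unfolding vadd_def by (simp only: nth_map nth_zip length_zip min.idem split)

lemma sg_nth_vadd [simp]:
  "p < length x \<Longrightarrow> length x = length y \<Longrightarrow> sg (vadd x y ! p) = sg (x ! p) * sg (y ! p)"
  by (simp only: nth_vadd sg_add)

lemma sg_inject: "sg a = sg b \<longleftrightarrow> a = b"
  by (cases a; cases b) simp_all

text \<open>\<open>sg\<close> turns addition of bits into multiplication of reals, so identities
  between words reduce to identities of real products in which \<open>sg_mult_self\<close> cancels
  repeated factors.\<close>

lemma word_eqI:
  "length x = length y \<Longrightarrow> (\<And>p. p < length x \<Longrightarrow> sg (x ! p) = sg (y ! p)) \<Longrightarrow> x = y"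
  by (rule nth_equalityI) (simp_all add: sg_inject)

lemma vadd_comm: "length x = length y \<Longrightarrow> vadd x y = vadd y x"
  by (rule word_eqI) auto

lemma vadd_assoc: "length x = length y \<Longrightarrow> length y = length z \<Longrightarrow> vadd (vadd x y) z = vadd x (vadd y z)"
  by (rule word_eqI) auto

lemma vadd_cancel: "length x = length y \<Longrightarrow> vadd x (vadd x y) = y"
  by (rule word_eqI) (auto simp flip: mult.assoc)

lemma vadd_zero: "length x = n \<Longrightarrow> vadd x (replicate n 0) = x"
  by (rule word_eqI) auto

lemma vadd_self: "length x = n \<Longrightarrow> vadd x x = replicate n 0"
  by (rule word_eqI) auto

section \<open>Correlation and Hamming distance\<close>

definition corr :: "word \<Rightarrow> word \<Rightarrow> real" where
  "corr x y = (\<Sum>p<length x. sg (x ! p) * sg (y ! p))"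

lemma corr_hamming: "corr x y = real (length x) - 2 * real (hamming_dist x y)"
proof -
  have "corr x y = (\<Sum>p<length x. 1 - 2 * of_bool (x ! p \<noteq> y ! p))"
    by (simp add: corr_def sg_mult)
  also have "\<dots> = real (length x) - 2 * (\<Sum>p<length x. of_bool (x ! p \<noteq> y ! p))"
    by (simp add: sum_subtractf sum_distrib_left)
  also have "(\<Sum>p<length x. of_bool (x ! p \<noteq> y ! p)) = real (card {p \<in> {..<length x}. x ! p \<noteq> y ! p})"
    by (simp add: Int_def)
  finally show ?thesis by (simp add: hamming_dist_def)
qed

lemma corr_comm: "length x = length y \<Longrightarrow> corr x y = corr y x"
  by (simp add: corr_def mult.commute)

lemma corr_self: "corr x x = real (length x)"
  by (simp add: corr_def)

lemma hamming_dist_comm: "length x = length y \<Longrightarrow> hamming_dist x y = hamming_dist y x"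
  unfolding hamming_dist_def by (rule arg_cong[where f=card]) auto

lemma hamming_dist_eq_0:
  assumes "length x = length y"
  shows "hamming_dist x y = 0 \<longleftrightarrow> x = y"
  using assms by (auto simp: hamming_dist_def list_eq_iff_nth_eq)

lemma corr_eq_length:
  assumes "length x = length y"
  shows "corr x y = real (length x) \<longleftrightarrow> x = y"
  using hamming_dist_eq_0[OF assms] by (simp add: corr_hamming)

text \<open>Both sides sum a product of three signs, so a translation may move from one argument to
  the other.\<close>

lemma corr_add:
  assumes "length x = n" "length y = n" "length z = n"
  shows "corr (vadd x y) z = corr x (vadd y z)"
  unfolding corr_def using assms by (simp add: mult.assoc)

section \<open>Gram identities\<close>

text \<open>These are the quadruples of positions in which every position occurs an even number of
  times, so that the product of the four signs is 1 at every word.\<close>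

definition pairing :: "'a \<Rightarrow> 'a \<Rightarrow> 'a \<Rightarrow> 'a \<Rightarrow> bool" where
  "pairing a b c d \<longleftrightarrow> (a = b \<and> c = d) \<or> (a = c \<and> b = d) \<or> (a = d \<and> b = c)"

text \<open>Any two of the three alternatives force all four entries to be equal; that case is
  counted three times and must be subtracted twice.\<close>

lemma of_bool_pairing:
  "(of_bool (pairing a b c d) :: real) =
     of_bool (b = a) * of_bool (c = d) + of_bool (c = a) * of_bool (b = d)
     + of_bool (d = a) * of_bool (b = c) - 2 * (of_bool (b = a) * (of_bool (c = a) * of_bool (d = a)))"
  by (auto simp: pairing_def)

lemma sum_delta_of_bool:
  fixes f :: "'a \<Rightarrow> real"
  assumes "finite P" "a \<in> P"
  shows "(\<Sum>b\<in>P. f b * of_bool (b = a)) = f a" "(\<Sum>b\<in>P. f b * of_bool (a = b)) = f a"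
  using assms by (simp_all add: of_bool_def if_distrib[where f="(*) _"] cong: if_cong)

text \<open>Each Kronecker delta collapses a sum. Weights 1 count the pairings; general weights
  serve to evaluate trilinear sums over the shortened code.\<close>

lemma sum_pairing:
  fixes f g h :: "'a \<Rightarrow> real"
  assumes P: "finite P" and a: "a \<in> P"
  shows "(\<Sum>b\<in>P. \<Sum>c\<in>P. \<Sum>d\<in>P. f b * g c * h d * of_bool (pairing a b c d)) =
    f a * (\<Sum>p\<in>P. g p * h p) + g a * (\<Sum>p\<in>P. f p * h p) + h a * (\<Sum>p\<in>P. f p * g p)
      - 2 * (f a * g a * h a)"
proof -
  have 1: "(\<Sum>b\<in>P. \<Sum>c\<in>P. \<Sum>d\<in>P. (f b * of_bool (b = a)) * (g c * (h d * of_bool (c = d))))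
      = f a * (\<Sum>p\<in>P. g p * h p)"
    using a by (simp add: P sum_delta_of_bool flip: sum_distrib_left sum_distrib_right)
  have 2: "(\<Sum>b\<in>P. \<Sum>c\<in>P. \<Sum>d\<in>P. (g c * of_bool (c = a)) * (f b * (h d * of_bool (b = d))))
      = g a * (\<Sum>p\<in>P. f p * h p)"
    using a by (simp add: P sum_delta_of_bool flip: sum_distrib_left sum_distrib_right)
  have 3: "(\<Sum>b\<in>P. \<Sum>c\<in>P. \<Sum>d\<in>P. (f b * (g c * of_bool (b = c))) * (h d * of_bool (d = a)))
      = h a * (\<Sum>p\<in>P. f p * g p)"
    using a by (simp add: P sum_delta_of_bool mult.commute flip: sum_distrib_left sum_distrib_right)
  have 4: "(\<Sum>b\<in>P. \<Sum>c\<in>P. \<Sum>d\<in>P. (f b * of_bool (b = a)) * ((g c * of_bool (c = a)) * (h d * of_bool (d = a))))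
      = f a * g a * h a"
    using a by (simp add: P sum_delta_of_bool flip: sum_distrib_left sum_distrib_right)
  have "(\<Sum>b\<in>P. \<Sum>c\<in>P. \<Sum>d\<in>P. f b * g c * h d * of_bool (pairing a b c d)) =
    (\<Sum>b\<in>P. \<Sum>c\<in>P. \<Sum>d\<in>P. (f b * of_bool (b = a)) * (g c * (h d * of_bool (c = d)))
       + (g c * of_bool (c = a)) * (f b * (h d * of_bool (b = d)))
       + (f b * (g c * of_bool (b = c))) * (h d * of_bool (d = a))
       - 2 * ((f b * of_bool (b = a)) * ((g c * of_bool (c = a)) * (h d * of_bool (d = a)))))"
    unfolding of_bool_pairing by (intro sum.cong refl) (simp add: algebra_simps)
  also have "\<dots> = f a * (\<Sum>p\<in>P. g p * h p) + g a * (\<Sum>p\<in>P. f p * h p) + h a * (\<Sum>p\<in>P. f p * g p)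
      - 2 * (f a * g a * h a)"
    by (simp add: sum.distrib sum_subtractf 1 2 3 4 flip: sum_distrib_left[where r=2])
  finally show ?thesis .
qed

lemma triple_product:
  fixes f g h :: "'a \<Rightarrow> real"
  shows "(\<Sum>i\<in>A. f i) * ((\<Sum>i\<in>A. g i) * (\<Sum>i\<in>A. h i)) = (\<Sum>i\<in>A. \<Sum>j\<in>A. \<Sum>k\<in>A. f i * (g j * h k))"
  by (simp only: sum_product) (simp only: sum_distrib_left)

text \<open>For the matrix \<open>S\<close> with entries \<open>s x p\<close>, the two sides are the
  squared Frobenius norms of the Gram matrices of its rows and of its columns.\<close>

lemma sum_power2_gram:
  fixes s :: "'a \<Rightarrow> 'b \<Rightarrow> real"
  shows "(\<Sum>x\<in>K. \<Sum>y\<in>K. (\<Sum>p\<in>P. s x p * s y p)\<^sup>2) =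
    (\<Sum>p\<in>P. \<Sum>q\<in>P. (\<Sum>x\<in>K. s x p * s x q)\<^sup>2)"
proof -
  have "(\<Sum>x\<in>K. \<Sum>y\<in>K. (\<Sum>p\<in>P. s x p * s y p)\<^sup>2) =
    (\<Sum>x\<in>K. \<Sum>y\<in>K. \<Sum>p\<in>P. \<Sum>q\<in>P. (s x p * s x q) * (s y p * s y q))"
    by (simp add: power2_eq_square sum_product mult_ac)
  also have "\<dots> = (\<Sum>x\<in>K. \<Sum>p\<in>P. \<Sum>y\<in>K. \<Sum>q\<in>P. (s x p * s x q) * (s y p * s y q))"
    by (subst sum.swap[where B=P]) simp
  also have "\<dots> = (\<Sum>p\<in>P. \<Sum>x\<in>K. \<Sum>q\<in>P. \<Sum>y\<in>K. (s x p * s x q) * (s y p * s y q))"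
    by (subst sum.swap[where B=P]) (subst (2) sum.swap[where B=P], simp)
  also have "\<dots> = (\<Sum>p\<in>P. \<Sum>q\<in>P. \<Sum>x\<in>K. \<Sum>y\<in>K. (s x p * s x q) * (s y p * s y q))"
    by (rule sum.cong[OF refl], rule sum.swap)
  also have "\<dots> = (\<Sum>p\<in>P. \<Sum>q\<in>P. (\<Sum>x\<in>K. s x p * s x q)\<^sup>2)"
    by (simp add: power2_eq_square sum_product)
  finally show ?thesis .
qed

text \<open>The square of an inner product is the inner product of the tensor squares, so
  \<open>sum_power2_gram\<close> applies to the vectors \<open>s x a * s x b\<close> indexed by
  pairs \<open>(a, b)\<close>.\<close>

lemma sum_power4_gram:
  fixes s :: "'a \<Rightarrow> 'b \<Rightarrow> real"
  shows "(\<Sum>x\<in>K. \<Sum>y\<in>K. (\<Sum>p\<in>P. s x p * s y p) ^ 4) =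
    (\<Sum>a\<in>P. \<Sum>b\<in>P. \<Sum>c\<in>P. \<Sum>d\<in>P. (\<Sum>x\<in>K. s x a * s x b * (s x c * s x d))\<^sup>2)"
proof -
  have "(\<Sum>p\<in>P. s x p * s y p) ^ 4 =
      (\<Sum>t\<in>P \<times> P. (s x (fst t) * s x (snd t)) * (s y (fst t) * s y (snd t)))\<^sup>2" for x y
  proof -
    have "(\<Sum>p\<in>P. s x p * s y p) ^ 4 = ((\<Sum>p\<in>P. s x p * s y p)\<^sup>2)\<^sup>2"
      by simp
    also have "(\<Sum>p\<in>P. s x p * s y p)\<^sup>2 =
        (\<Sum>t\<in>P \<times> P. (s x (fst t) * s x (snd t)) * (s y (fst t) * s y (snd t)))"
      by (simp add: power2_eq_square sum_product sum.cartesian_product split_beta mult_ac)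
    finally show ?thesis .
  qed
  then have "(\<Sum>x\<in>K. \<Sum>y\<in>K. (\<Sum>p\<in>P. s x p * s y p) ^ 4) =
      (\<Sum>t\<in>P \<times> P. \<Sum>u\<in>P \<times> P.
        (\<Sum>x\<in>K. s x (fst t) * s x (snd t) * (s x (fst u) * s x (snd u)))\<^sup>2)"
    by (simp only: sum_power2_gram[where s = "\<lambda>x t. s x (fst t) * s x (snd t)"])
  also have "\<dots> = (\<Sum>a\<in>P. \<Sum>b\<in>P. \<Sum>c\<in>P. \<Sum>d\<in>P. (\<Sum>x\<in>K. s x a * s x b * (s x c * s x d))\<^sup>2)"
    by (simp only: sum.cartesian_product' fst_conv snd_conv)
  finally show ?thesis .
qed

section \<open>Cosets of the first order Reed-Muller code\<close>

text \<open>The features of RM(1,m) on which the argument rests. The bound on the size is sharpened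
  to an equality in \<open>card_R\<close>.\<close>

locale first_order =
  fixes n :: nat and R :: "word set"
  assumes n_ge_2: "2 \<le> n"
    and R_length: "r \<in> R \<Longrightarrow> length r = n"
    and R_zero: "replicate n 0 \<in> R"
    and R_one: "replicate n 1 \<in> R"
    and R_add: "r \<in> R \<Longrightarrow> t \<in> R \<Longrightarrow> vadd r t \<in> R"
    and R_separates: "p < n \<Longrightarrow> q < n \<Longrightarrow> p \<noteq> q \<Longrightarrow> \<exists>r\<in>R. r ! p \<noteq> r ! q"
    and card_R_le: "card R \<le> 2 * n"
begin

section \<open>Orthogonality and Parseval's identity\<close>

lemma finite_words: "finite {x :: word. length x = n}"
  using finite_lists_length_eq[of "{0, 1 :: bit}" n] by (rule finite_subset[rotated]) auto

lemma finite_R: "finite R"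
  using finite_words by (rule finite_subset[rotated]) (auto simp: R_length)

lemma bij_betw_add_R:
  assumes "length x = n"
  shows "bij_betw (vadd x) R {y. length y = n \<and> vadd x y \<in> R}"
  by (rule bij_betw_byWitness[where f' = "vadd x"]) (use assms in \<open>auto simp: R_length vadd_cancel\<close>)

text \<open>Translation by a word \<open>t\<close> of \<open>R\<close> that separates
  \<open>p\<close> and \<open>q\<close> permutes \<open>R\<close> and negates every term.\<close>

lemma sum_R_pair:
  assumes "p < n" "q < n" "p \<noteq> q"
  shows "(\<Sum>r\<in>R. sg (r ! p) * sg (r ! q)) = 0"
proof -
  obtain t where t: "t \<in> R" "t ! p \<noteq> t ! q"
    using R_separates[OF assms] by blast
  have bij: "bij_betw (vadd t) R R"
    by (rule bij_betw_byWitness[where f' = "vadd t"]) (auto simp: R_length t R_add vadd_cancel)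
  have tt: "sg (t ! p) * sg (t ! q) = -1"
    using t(2) by (cases "t ! p"; cases "t ! q") auto
  have "(\<Sum>r\<in>R. sg (r ! p) * sg (r ! q)) = (\<Sum>r\<in>R. sg (vadd t r ! p) * sg (vadd t r ! q))"
    by (rule sum.reindex_bij_betw[OF bij, symmetric])
  also have "\<dots> = (\<Sum>r\<in>R. (sg (t ! p) * sg (t ! q)) * (sg (r ! p) * sg (r ! q)))"
    using assms t(1) by (intro sum.cong) (simp_all add: R_length mult_ac)
  also have "\<dots> = - (\<Sum>r\<in>R. sg (r ! p) * sg (r ! q))"
    by (simp add: tt sum_negf)
  finally show ?thesis by simp
qed

text \<open>By \<open>sum_R_pair\<close> only the diagonal terms of the expanded square
  survive.\<close>

lemma parseval:
  assumes u: "length u = n"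
  shows "(\<Sum>r\<in>R. (corr u r)\<^sup>2) = real (card R) * real n"
proof -
  have "(\<Sum>r\<in>R. (corr u r)\<^sup>2) =
      (\<Sum>r\<in>R. \<Sum>p<n. \<Sum>q<n. (sg (u ! p) * sg (u ! q)) * (sg (r ! p) * sg (r ! q)))"
    by (simp add: corr_def u power2_eq_square sum_product mult_ac)
  also have "\<dots> = (\<Sum>p<n. \<Sum>r\<in>R. \<Sum>q<n. (sg (u ! p) * sg (u ! q)) * (sg (r ! p) * sg (r ! q)))"
    by (rule sum.swap)
  also have "\<dots> = (\<Sum>p<n. \<Sum>q<n. \<Sum>r\<in>R. (sg (u ! p) * sg (u ! q)) * (sg (r ! p) * sg (r ! q)))"
    by (rule sum.cong[OF refl], rule sum.swap)
  also have "\<dots> = (\<Sum>p<n. \<Sum>q<n. real (card R) * of_bool (q = p))"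
  proof (intro sum.cong refl)
    fix p q assume "p \<in> {..<n}" "q \<in> {..<n}"
    then show "(\<Sum>r\<in>R. (sg (u ! p) * sg (u ! q)) * (sg (r ! p) * sg (r ! q))) =
        real (card R) * of_bool (q = p)"
      using sum_R_pair[of p q] by (cases "q = p") (simp_all flip: sum_distrib_left)
  qed
  also have "\<dots> = real (card R) * real n"
    by (simp add: sum_delta_of_bool)
  finally show ?thesis .
qed

section \<open>Correlations within a coset\<close>

lemma corr_zero_zero: "corr (replicate n 0) (replicate n 0) = real n"
  by (simp add: corr_self)

lemma corr_zero_one: "corr (replicate n 0) (replicate n 1) = - real n"
  by (simp add: corr_def)

lemma zero_neq_one: "replicate n (0 :: bit) \<noteq> replicate n 1"
  using n_ge_2 by (cases n) auto

text \<open>The zero word and the all-one word alone contribute 2n^2 to the Parseval sum of the zero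
  word, which is n times the size of \<open>R\<close>.\<close>

lemma card_R: "card R = 2 * n"
proof -
  let ?f = "\<lambda>r. (corr (replicate n 0) r)\<^sup>2"
  have "2 * real n * real n = sum ?f {replicate n 0, replicate n 1}"
    using zero_neq_one by (simp add: corr_zero_zero corr_zero_one power2_eq_square)
  also have "\<dots> \<le> sum ?f R"
    by (intro sum_mono2 finite_R) (auto simp: R_zero R_one)
  also have "\<dots> = real (card R) * real n"
    by (rule parseval) simp
  finally have "2 * real n \<le> real (card R)"
    using n_ge_2 by simp
  then show ?thesis using card_R_le by linarith
qed

text \<open>Since \<open>R\<close> has exactly 2n words, the zero word and the all-one word exhaust
  the Parseval sum, and all other squares vanish.\<close>

lemma corr_zero_R:
  assumes "r \<in> R" "r \<noteq> replicate n 0" "r \<noteq> replicate n 1"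
  shows "corr (replicate n 0) r = 0"
proof -
  let ?f = "\<lambda>r. (corr (replicate n 0) r)\<^sup>2"
  let ?A = "{replicate n 0, replicate n 1}"
  have "sum ?f R = 2 * real n * real n"
    by (subst parseval) (simp_all add: card_R)
  also have "\<dots> = sum ?f ?A"
    using zero_neq_one by (simp add: corr_zero_zero corr_zero_one power2_eq_square)
  finally have "sum ?f R = sum ?f ?A" .
  moreover have "sum ?f R = sum ?f (R - ?A) + sum ?f ?A"
    by (rule sum.subset_diff) (auto simp: R_zero R_one finite_R)
  ultimately have "sum ?f (R - ?A) = 0" by simp
  then show ?thesis
    using assms finite_R by (subst (asm) sum_nonneg_eq_0_iff) auto
qed

lemma corr_eq_corr_zero:
  assumes "length x = n" "length y = n"
  shows "corr x y = corr (replicate n 0) (vadd x y)"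
  using corr_add[of x n "replicate n 0" y] corr_add[of "replicate n 0" n x y] vadd_zero[of x n]
    vadd_comm[of x "replicate n 0"] assms by simp

lemma corr_same_coset:
  assumes "length x = n" "length y = n" "vadd x y \<in> R"
  shows "corr x y \<in> {0, real n, - real n}"
  using corr_zero_R[OF assms(3)] corr_zero_zero corr_zero_one
  by (cases "vadd x y = replicate n 0 \<or> vadd x y = replicate n 1")
     (auto simp only: corr_eq_corr_zero[OF assms(1,2)] insert_iff)

lemma sum_corr_R_power4:
  "(\<Sum>r\<in>R. corr (replicate n 0) r ^ 4) = 2 * real n ^ 4"
proof -
  let ?f = "\<lambda>r. corr (replicate n 0) r ^ 4"
  have "sum ?f R = sum ?f {replicate n 0, replicate n 1}"
    by (rule sum.mono_neutral_right) (auto simp: finite_R R_zero R_one corr_zero_R)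
  then show ?thesis using zero_neq_one by (simp add: corr_zero_zero corr_zero_one)
qed

section \<open>Partition into cosets\<close>

lemma coset_conv_image: "coset u R = vadd u ` R"
  by (auto simp: coset_def vadd_def)

lemma coset_eq:
  assumes "length u = n" "y \<in> coset u R"
  shows "coset y R = coset u R"
proof -
  obtain r where r: "r \<in> R" "y = vadd u r" using assms(2) by (auto simp: coset_conv_image)
  have rr: "vadd r (vadd r t) = t" if "t \<in> R" for t
    using that r(1) by (simp add: vadd_cancel R_length)
  have "coset y R = (\<lambda>t. vadd u (vadd r t)) ` R"
    using r assms(1) by (simp add: coset_conv_image vadd_assoc R_length)
  also have "\<dots> = vadd u ` (vadd r ` R)" by (simp add: image_image)
  also have "vadd r ` R = R"
  proof
    show "vadd r ` R \<subseteq> R" using r(1) R_add by blast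
    show "R \<subseteq> vadd r ` R" using r(1) R_add rr by (metis image_eqI subsetI)
  qed
  finally show ?thesis by (simp add: coset_conv_image)
qed

lemma card_coset:
  assumes "length u = n"
  shows "card (coset u R) = 2 * n"
  unfolding coset_conv_image card_R[symmetric]
  using bij_betw_add_R[OF assms] by (intro card_image) (simp add: bij_betw_def)

lemma coset_zero: "coset (replicate n 0) R = R"
  by (auto simp: coset_conv_image image_iff R_length vadd_comm[of "replicate n 0"] vadd_zero)

end

section \<open>Kerdock codes\<close>

text \<open>The minimum distance d = (n - sqrt n)/2 enters as \<open>corr_le\<close>, because n - 2d
  = sqrt n. The size is that of n/2 cosets with 2n words each.\<close>

locale kerdock = first_order +
  fixes K :: "word set"
  assumes K_length: "x \<in> K \<Longrightarrow> length x = n"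
    and K_add: "x \<in> K \<Longrightarrow> r \<in> R \<Longrightarrow> vadd x r \<in> K"
    and card_K: "card K = n\<^sup>2"
    and corr_le: "x \<in> K \<Longrightarrow> y \<in> K \<Longrightarrow> x \<noteq> y \<Longrightarrow> corr x y \<le> sqrt (real n)"
begin

lemma finite_K: "finite K"
  using finite_words by (rule finite_subset[rotated]) (auto simp: K_length)

text \<open>All translates of \<open>x\<close> by \<open>R\<close> lie in \<open>K\<close> and
  differ from \<open>y\<close>, and complements are among them, so each correlation with
  \<open>y\<close> is at most sqrt n in absolute value. By Parseval the mean of their squares is n,
  which forces equality everywhere.\<close>

lemma corr_cosets:
  assumes x: "x \<in> K" and y: "y \<in> K" and xy: "vadd x y \<notin> R"
  shows "(corr x y)\<^sup>2 = real n"
proof -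
  have le: "corr (vadd x r) y \<le> sqrt (real n)" if r: "r \<in> R" for r
  proof (rule corr_le[OF K_add[OF x r] y])
    show "vadd x r \<noteq> y"
      using xy r x by (metis K_length R_length vadd_cancel)
  qed
  have ge: "- sqrt (real n) \<le> corr (vadd x r) y" if r: "r \<in> R" for r
  proof -
    have "corr (vadd x (vadd r (replicate n 1))) y = - corr (vadd x r) y"
      unfolding corr_def using K_length[OF x] R_length[OF r] K_length[OF y]
      by (simp flip: sum_negf)
    then show ?thesis using le[OF R_add[OF r R_one]] by simp
  qed
  have sq: "(corr (vadd x r) y)\<^sup>2 \<le> real n" if r: "r \<in> R" for r
    using le[OF r] ge[OF r] by (metis abs_le_iff minus_le_iff real_sqrt_abs real_sqrt_le_iff)
  have "(\<Sum>r\<in>R. (corr (vadd x r) y)\<^sup>2) = (\<Sum>r\<in>R. (corr (vadd x y) r)\<^sup>2)"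
    using K_length[OF x] K_length[OF y]
    by (intro sum.cong refl arg_cong[where f="\<lambda>c. c\<^sup>2"])
      (metis R_length corr_add vadd_comm)
  also have "\<dots> = (\<Sum>r\<in>R. real n)"
    using K_length[OF x] K_length[OF y] by (simp add: parseval)
  finally have "(\<Sum>r\<in>R. real n - (corr (vadd x r) y)\<^sup>2) = 0"
    by (simp add: sum_subtractf)
  then have "\<forall>r\<in>R. real n - (corr (vadd x r) y)\<^sup>2 = 0"
    by (subst (asm) sum_nonneg_eq_0_iff) (auto simp: finite_R sq)
  then show ?thesis using R_zero K_length[OF x] by (auto simp: vadd_zero)
qed

text \<open>In the coset of \<open>x\<close> only \<open>x\<close> and its complement contribute,
  n^4 each; each of the n^2 - 2n words outside contributes n^2. The resulting mean 3n^2 - 2n is the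
  fourth moment of a sum of n independent random signs.\<close>

lemma sum_corr_power4:
  assumes x: "x \<in> K"
  shows "(\<Sum>y\<in>K. corr x y ^ 4) = real n ^ 2 * (3 * real n ^ 2 - 2 * real n)"
proof -
  let ?C = "{y. length y = n \<and> vadd x y \<in> R}"
  have xl: "length x = n" using x by (rule K_length)
  have sub: "?C \<subseteq> K"
  proof
    fix y assume "y \<in> ?C"
    then show "y \<in> K" using K_add[OF x, of "vadd x y"] xl by (simp add: vadd_cancel)
  qed
  have "card ?C = 2 * n"
    using bij_betw_same_card[OF bij_betw_add_R[OF xl]] card_R by simp
  then have card: "real (card (K - ?C)) = real n ^ 2 - 2 * real n"
    using sub finite_K card_K card_mono[OF finite_K sub]
    by (simp add: card_Diff_subset finite_subset of_nat_diff)
  have "(\<Sum>y\<in>?C. corr x y ^ 4) = (\<Sum>r\<in>R. corr x (vadd x r) ^ 4)"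
    by (rule sum.reindex_bij_betw[OF bij_betw_add_R[OF xl], symmetric])
  also have "\<dots> = (\<Sum>r\<in>R. corr (replicate n 0) r ^ 4)"
    using xl by (intro sum.cong refl arg_cong[where f="\<lambda>c. c ^ 4"])
      (subst corr_eq_corr_zero, simp_all add: R_length vadd_cancel)
  finally have C: "(\<Sum>y\<in>?C. corr x y ^ 4) = 2 * real n ^ 4"
    by (simp add: sum_corr_R_power4)
  have "corr x y ^ 4 = real n ^ 2" if "y \<in> K - ?C" for y
  proof -
    have "(corr x y)\<^sup>2 = real n"
      using corr_cosets[OF x] that K_length by auto
    then have "((corr x y)\<^sup>2)\<^sup>2 = real n ^ 2" by simp
    then show ?thesis by simp
  qed
  then have "(\<Sum>y\<in>K - ?C. corr x y ^ 4) = (real n ^ 2 - 2 * real n) * real n ^ 2"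
    by (simp add: card)
  then show ?thesis
    using C sum.subset_diff[OF sub finite_K, of "\<lambda>y. corr x y ^ 4"]
    by (simp add: algebra_simps power2_eq_square power4_eq_xxxx)
qed

text \<open>The squares of the character sums of order four add up to the total fourth moment. The
  paired quadruples already account for all of it, so the other sums vanish.\<close>

lemma sum_K_four:
  assumes "a < n" "b < n" "c < n" "d < n"
  shows "(\<Sum>x\<in>K. sg (x ! a) * sg (x ! b) * (sg (x ! c) * sg (x ! d))) =
    real (card K) * of_bool (pairing a b c d)"
proof -
  let ?P = "{..<n}"
  define E where "E a b c d = (\<Sum>x\<in>K. sg (x ! a) * sg (x ! b) * (sg (x ! c) * sg (x ! d)))" for a b c d
  define k where "k = real (card K)"
  have E_pairing: "E a b c d = k" if "pairing a b c d" for a b c d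
  proof -
    have "sg (x ! a) * sg (x ! b) * (sg (x ! c) * sg (x ! d)) = 1" for x
      using that by (cases "x ! a"; cases "x ! b"; cases "x ! c") (auto simp: pairing_def)
    then show ?thesis by (simp add: E_def k_def)
  qed
  have "(\<Sum>a\<in>?P. \<Sum>b\<in>?P. \<Sum>c\<in>?P. \<Sum>d\<in>?P. (E a b c d)\<^sup>2) = (\<Sum>x\<in>K. \<Sum>y\<in>K. corr x y ^ 4)"
    using sum_power4_gram[of "\<lambda>x p. sg (x ! p)" ?P K]
    by (simp add: E_def corr_def K_length)
  \<comment> \<open>One factor n^2 of the fourth moment is read as the size \<open>k\<close> of the
    code.\<close>
  also have "\<dots> = k * (k * (3 * real n ^ 2 - 2 * real n))"
    by (simp add: sum_corr_power4 k_def card_K)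
  also have "\<dots> = (\<Sum>a\<in>?P. \<Sum>b\<in>?P. \<Sum>c\<in>?P. \<Sum>d\<in>?P. k\<^sup>2 * of_bool (pairing a b c d))"
  proof -
    \<comment> \<open>With all weights 1, \<open>sum_pairing\<close> counts the pairings whose first
      entry is \<open>a\<close>.\<close>
    have "(\<Sum>b\<in>?P. \<Sum>c\<in>?P. \<Sum>d\<in>?P. of_bool (pairing a b c d)) = 3 * real n - 2"
      if "a \<in> ?P" for a
      using sum_pairing[of ?P a "\<lambda>_. 1" "\<lambda>_. 1" "\<lambda>_. 1"] that by simp
    then have "(\<Sum>a\<in>?P. \<Sum>b\<in>?P. \<Sum>c\<in>?P. \<Sum>d\<in>?P. k\<^sup>2 * of_bool (pairing a b c d)) =
        k\<^sup>2 * (\<Sum>a\<in>?P. 3 * real n - 2)"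
      unfolding sum_distrib_left[symmetric] by (intro arg_cong2[where f="(*)"] sum.cong refl)
    then show ?thesis
      by (simp add: power2_eq_square algebra_simps)
  qed
  finally have "(\<Sum>a\<in>?P. \<Sum>b\<in>?P. \<Sum>c\<in>?P. \<Sum>d\<in>?P. (E a b c d)\<^sup>2 - k\<^sup>2 * of_bool (pairing a b c d)) = 0"
    by (simp add: sum_subtractf)
  then have sum0: "(\<Sum>(a, b, c, d)\<in>?P \<times> ?P \<times> ?P \<times> ?P. (E a b c d)\<^sup>2 - k\<^sup>2 * of_bool (pairing a b c d)) = 0"
    by (simp only: sum.cartesian_product' prod.case)
  have nonneg: "0 \<le> (E a b c d)\<^sup>2 - k\<^sup>2 * of_bool (pairing a b c d)" for a b c d
    by (cases "pairing a b c d") (simp_all add: E_pairing)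
  have "\<forall>t\<in>?P \<times> ?P \<times> ?P \<times> ?P. (case t of (a, b, c, d) \<Rightarrow>
      (E a b c d)\<^sup>2 - k\<^sup>2 * of_bool (pairing a b c d)) = 0"
    by (rule sum_nonneg_eq_0_iff[THEN iffD1, OF _ _ sum0]) (use nonneg in auto)
  then have "(E a b c d)\<^sup>2 - k\<^sup>2 * of_bool (pairing a b c d) = 0"
    using assms by fastforce
  then show ?thesis
    unfolding E_def[symmetric] k_def[symmetric]
    using E_pairing[of a b c d] by (cases "pairing a b c d") simp_all
qed

lemma bij_betw_complement_K: "bij_betw (\<lambda>z. vadd z (replicate n 1)) K K"
  by (rule bij_betw_byWitness[where f' = "\<lambda>z. vadd z (replicate n 1)"])
    (auto simp: K_add K_length R_one vadd_assoc vadd_self vadd_zero)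

text \<open>Complementation permutes \<open>K\<close> and negates every product of an odd number of
  signs. Lists of positions allow repetitions.\<close>

lemma sum_K_odd:
  assumes "odd (length ps)" "set ps \<subseteq> {..<n}"
  shows "(\<Sum>z\<in>K. \<Prod>i\<leftarrow>ps. sg (z ! i)) = 0"
proof -
  have neg: "(\<Prod>i\<leftarrow>qs. sg (vadd z (replicate n 1) ! i)) = (-1) ^ length qs * (\<Prod>i\<leftarrow>qs. sg (z ! i))"
    if "z \<in> K" "set qs \<subseteq> {..<n}" for z qs
    using that(2) by (induction qs) (simp_all add: K_length that(1))
  have "(\<Sum>z\<in>K. \<Prod>i\<leftarrow>ps. sg (z ! i)) = (\<Sum>z\<in>K. \<Prod>i\<leftarrow>ps. sg (vadd z (replicate n 1) ! i))"
    by (rule sum.reindex_bij_betw[OF bij_betw_complement_K, symmetric])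
  also have "\<dots> = (\<Sum>z\<in>K. - (\<Prod>i\<leftarrow>ps. sg (z ! i)))"
    using assms by (intro sum.cong) (simp_all add: neg)
  finally show ?thesis by (simp add: sum_negf)
qed

end

section \<open>Moments and intersection numbers of the shortened code\<close>

text \<open>Both \<open>p\<close> and \<open>q\<close> are positions of the original words of length
  \<open>n\<close>, unlike the second position in \<open>doubly_shortened\<close>.\<close>

locale shortened_kerdock = kerdock +
  fixes p q :: nat
  assumes p: "p < n" and q: "q < n" and p_neq_q: "p \<noteq> q"
begin

text \<open>The words of the doubly shortened code before the two zero positions are deleted.\<close>

definition K0 :: "word set" where
  "K0 = {z \<in> K. z ! p = 0 \<and> z ! q = 0}"

lemma K0_length: "z \<in> K0 \<Longrightarrow> length z = n"
  by (simp add: K0_def K_length)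

lemma finite_K0: "finite K0"
  by (simp add: K0_def finite_K)

text \<open>\<open>(1 + sg (z ! p)) * (1 + sg (z ! q)) / 4\<close> is the indicator function of \<open>K0\<close>.\<close>

lemma sum_K0: "(\<Sum>z\<in>K0. f z) = (\<Sum>z\<in>K. (1 + sg (z ! p)) * (1 + sg (z ! q)) * f z) / 4"
proof -
  have "(\<Sum>z\<in>K. (1 + sg (z ! p)) * (1 + sg (z ! q)) * f z) = (\<Sum>z\<in>K0. 4 * f z)"
    unfolding K0_def by (rule sum.mono_neutral_cong_right) (auto simp: finite_K sg_def split: if_splits)
  then show ?thesis by (simp flip: sum_distrib_left)
qed

text \<open>Expanding the indicator of \<open>K0\<close> gives character sums of orders 3, 4, 4 and
  5. The odd ones vanish, and those of order four are given by \<open>sum_K_four\<close>.\<close>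

lemma sum_K0_triple:
  assumes "i < n" "j < n" "k < n"
  shows "(\<Sum>z\<in>K0. sg (z ! i) * (sg (z ! j) * sg (z ! k))) =
    real (card K) / 4 * (of_bool (pairing p i j k) + of_bool (pairing q i j k))"
proof -
  have "(\<Sum>z\<in>K0. sg (z ! i) * (sg (z ! j) * sg (z ! k))) = (\<Sum>z\<in>K.
      (\<Prod>i\<leftarrow>[i, j, k]. sg (z ! i)) + (\<Prod>i\<leftarrow>[p, q, i, j, k]. sg (z ! i))
      + sg (z ! p) * sg (z ! i) * (sg (z ! j) * sg (z ! k))
      + sg (z ! q) * sg (z ! i) * (sg (z ! j) * sg (z ! k))) / 4"
    unfolding sum_K0 by (simp add: algebra_simps)
  then show ?thesis
    using assms p q sum_K_odd[of "[i, j, k]"] sum_K_odd[of "[p, q, i, j, k]"]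
    by (simp only: sum.distrib sum_K_four) (simp add: algebra_simps)
qed

text \<open>After expansion, \<open>sum_pairing\<close> applies once with first entry
  \<open>p\<close> and once with \<open>q\<close>. Only pairwise inner products of the coefficient
  vectors and their values at \<open>p\<close> and \<open>q\<close> remain.\<close>

lemma sum_K0_trilinear:
  "(\<Sum>z\<in>K0. (\<Sum>i<n. f i * sg (z ! i)) * ((\<Sum>i<n. g i * sg (z ! i)) * (\<Sum>i<n. h i * sg (z ! i)))) =
    real (card K) / 4 * (\<Sum>a\<in>{p, q}.
      f a * (\<Sum>i<n. g i * h i) + g a * (\<Sum>i<n. f i * h i) + h a * (\<Sum>i<n. f i * g i)
      - 2 * (f a * g a * h a))"
proof -
  have "(\<Sum>z\<in>K0. (\<Sum>i<n. f i * sg (z ! i)) * ((\<Sum>i<n. g i * sg (z ! i)) * (\<Sum>i<n. h i * sg (z ! i)))) =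
    (\<Sum>z\<in>K0. \<Sum>i<n. \<Sum>j<n. \<Sum>k<n. (f i * g j * h k) * (sg (z ! i) * (sg (z ! j) * sg (z ! k))))"
    unfolding triple_product by (simp add: mult_ac)
  also have "\<dots> = (\<Sum>i<n. \<Sum>z\<in>K0. \<Sum>j<n. \<Sum>k<n. (f i * g j * h k) * (sg (z ! i) * (sg (z ! j) * sg (z ! k))))"
    by (rule sum.swap)
  also have "\<dots> = (\<Sum>i<n. \<Sum>j<n. \<Sum>z\<in>K0. \<Sum>k<n. (f i * g j * h k) * (sg (z ! i) * (sg (z ! j) * sg (z ! k))))"
    by (rule sum.cong[OF refl], rule sum.swap)
  also have "\<dots> = (\<Sum>i<n. \<Sum>j<n. \<Sum>k<n. \<Sum>z\<in>K0. (f i * g j * h k) * (sg (z ! i) * (sg (z ! j) * sg (z ! k))))"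
    by (rule sum.cong[OF refl], rule sum.cong[OF refl], rule sum.swap)
  also have "\<dots> = (\<Sum>i<n. \<Sum>j<n. \<Sum>k<n. real (card K) / 4 * (f i * g j * h k * of_bool (pairing p i j k))
      + real (card K) / 4 * (f i * g j * h k * of_bool (pairing q i j k)))"
    by (intro sum.cong refl) (simp add: sum_K0_triple algebra_simps flip: sum_distrib_left)
  also have "\<dots> = real (card K) / 4 *
      ((\<Sum>i<n. \<Sum>j<n. \<Sum>k<n. f i * g j * h k * of_bool (pairing p i j k))
      + (\<Sum>i<n. \<Sum>j<n. \<Sum>k<n. f i * g j * h k * of_bool (pairing q i j k)))"
    by (simp only: sum.distrib distrib_left sum_distrib_left)
  finally show ?thesis
    unfolding sum_pairing[OF finite_lessThan p[folded lessThan_iff]]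
      sum_pairing[OF finite_lessThan q[folded lessThan_iff]]
    using p_neq_q by simp
qed

text \<open>With the sign vectors of \<open>x\<close> and \<open>y\<close> as coefficients,
  \<open>sum_K0_trilinear\<close> involves only \<open>n\<close>, \<open>corr x y\<close> and the
  signs at \<open>p\<close> and \<open>q\<close>, which are 1. The case a = b = 2 would lead to
  character sums of order up to six.\<close>

lemma sum_K0_moment:
  assumes "x \<in> K0" "y \<in> K0" "a + b \<le> 3" "a \<le> 2" "b \<le> 2"
  shows "(\<Sum>z\<in>K0. corr x z ^ a * corr y z ^ b) = real (card K) / 4 *
    (if a + b = 0 then 1 else if a + b = 1 then 2 else if a + b = 3 then 2 * real n + 4 * corr x y - 4
     else if a = 1 then corr x y + 2 else real n + 2)"
proof -
  \<comment> \<open>As \<open>z ! p = 0\<close> on \<open>K0\<close>, the linear form with coefficients \<open>d\<close> is constantly 1, so moments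
    of lower order are trilinear sums too.\<close>
  define d :: "nat \<Rightarrow> real" where "d i = of_bool (i = p)" for i
  have d_at: "d p = 1" "d q = 0"
    using p_neq_q by (simp_all add: d_def)
  let ?x = "\<lambda>i. sg (x ! i)" and ?y = "\<lambda>i. sg (y ! i)"
  have len: "length x = n" "length y = n" and at: "x ! p = 0" "x ! q = 0" "y ! p = 0" "y ! q = 0"
    using assms(1,2) by (simp_all add: K0_def K_length)
  have c: "corr x z = (\<Sum>i<n. ?x i * sg (z ! i))" "corr y z = (\<Sum>i<n. ?y i * sg (z ! i))" for z
    by (simp_all add: corr_def len)
  have cyx: "(\<Sum>i<n. ?y i * ?x i) = (\<Sum>i<n. ?x i * ?y i)"
    by (simp add: mult.commute)
  have d_sum: "(\<Sum>i<n. d i * f i) = f p" "(\<Sum>i<n. f i * d i) = f p" for f :: "nat \<Rightarrow> real"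
    using p sum_delta_of_bool(1)[of "{..<n}" p f] by (simp_all only: d_def mult.commute finite_lessThan lessThan_iff simp_thms)
  have one: "(\<Sum>i<n. d i * sg (z ! i)) = 1" if "z \<in> K0" for z
    using that by (simp add: d_sum K0_def)
  \<comment> \<open>In the sum over \<open>{p, q}\<close> the name \<open>a\<close> denotes a
    position and shadows the exponent.\<close>
  have T: "(\<Sum>z\<in>K0. corr x z ^ a * corr y z ^ b) = real (card K) / 4 * (\<Sum>a\<in>{p, q}.
      f a * (\<Sum>i<n. g i * h i) + g a * (\<Sum>i<n. f i * h i) + h a * (\<Sum>i<n. f i * g i)
      - 2 * (f a * g a * h a))"
    if "\<And>z. z \<in> K0 \<Longrightarrow> corr x z ^ a * corr y z ^ b =
      (\<Sum>i<n. f i * sg (z ! i)) * ((\<Sum>i<n. g i * sg (z ! i)) * (\<Sum>i<n. h i * sg (z ! i)))" for f g h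
    unfolding sum_K0_trilinear[of f g h, symmetric] using that by (rule sum.cong[OF refl])
  note simps = d_sum d_at at p_neq_q p_neq_q[symmetric] cyx
  have "a \<in> {0, 1, 2}" "b \<in> {0, 1, 2}" using assms(4,5) by auto
  then consider "a = 0" "b = 0" | "a = 1" "b = 0" | "a = 0" "b = 1" | "a = 2" "b = 0" | "a = 0" "b = 2"
    | "a = 1" "b = 1" | "a = 2" "b = 1" | "a = 1" "b = 2"
    using assms(3) by auto
  then show ?thesis
  proof cases
    case 1
    show ?thesis
      by (subst T[of d d d], use 1 in \<open>simp add: one c power2_eq_square\<close>)
        (use 1 in \<open>simp add: simps\<close>)
  next
    case 2
    show ?thesis
      by (subst T[of ?x d d], use 2 in \<open>simp add: one c power2_eq_square\<close>)
        (use 2 in \<open>simp add: simps\<close>)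
  next
    case 3
    show ?thesis
      by (subst T[of ?y d d], use 3 in \<open>simp add: one c power2_eq_square\<close>)
        (use 3 in \<open>simp add: simps\<close>)
  next
    case 4
    show ?thesis
      by (subst T[of ?x ?x d], use 4 in \<open>simp add: one c power2_eq_square\<close>)
        (use 4 in \<open>simp add: simps\<close>)
  next
    case 5
    show ?thesis
      by (subst T[of ?y ?y d], use 5 in \<open>simp add: one c power2_eq_square\<close>)
        (use 5 in \<open>simp add: simps\<close>)
  next
    case 6
    show ?thesis
      by (subst T[of ?x ?y d], use 6 in \<open>simp add: one c power2_eq_square\<close>)
        (use 6 in \<open>simp add: simps c\<close>)
  next
    case 7
    show ?thesis
      by (subst T[of ?x ?x ?y], use 7 in \<open>simp add: one c power2_eq_square\<close>)
        (use 7 in \<open>simp add: simps c\<close>)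
  next
    case 8
    show ?thesis
      by (subst T[of ?x ?y ?y], use 8 in \<open>simp add: one c power2_eq_square\<close>)
        (use 8 in \<open>simp add: simps c\<close>)
  qed
qed

section \<open>The coset relation and the moment with exponents 2, 2\<close>

lemma add_in_R_trans:
  assumes "length x = n" "length y = n" "length z = n" "vadd x y \<in> R" "vadd x z \<in> R"
  shows "vadd y z \<in> R"
proof -
  have "vadd (vadd x y) (vadd x z) = vadd y z"
    by (rule word_eqI) (use assms in \<open>auto simp: sg_def[of "x ! _"]\<close>)
  then show ?thesis using R_add[OF assms(4,5)] by simp
qed

text \<open>Within a coset the correlation is 0, n or -n. The value n would make the words equal,
  and -n would make them complementary although they agree at \<open>p\<close>.\<close>

lemma corr_K0:
  assumes "x \<in> K0" "z \<in> K0" "x \<noteq> z"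
  shows "if vadd x z \<in> R then corr x z = 0 else (corr x z)\<^sup>2 = real n"
proof (cases "vadd x z \<in> R")
  case True
  have len: "length x = n" "length z = n" using assms by (auto simp: K0_length)
  have "corr x z \<noteq> real n"
    using corr_eq_length[of x z] assms(3) len by simp
  moreover have "corr x z \<noteq> - real n"
  proof -
    have "hamming_dist x z \<le> card ({..<n} - {p})"
      unfolding hamming_dist_def using assms(1,2) by (intro card_mono) (auto simp: K0_def K_length)
    then have "hamming_dist x z < n" using p by simp
    then show ?thesis by (simp add: corr_hamming len)
  qed
  ultimately show ?thesis
    using corr_same_coset[OF len True] True by simp
next
  case False
  then show ?thesis using corr_cosets assms by (simp add: K0_def)
qed

lemma corr_K0_cases:
  assumes "x \<in> K0" "z \<in> K0" "x \<noteq> z"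
  shows "corr x z = 0 \<or> (corr x z)\<^sup>2 = real n"
  using corr_K0[OF assms] by (auto split: if_splits)

text \<open>Away from \<open>x\<close> and \<open>y\<close>, the squared correlations divided by n
  are the indicators A, B of \<open>z\<close> lying outside the coset of \<open>x\<close>, of
  \<open>y\<close>. If these cosets coincide, then A = B and AB = A; otherwise (1 - A)(1 - B) = 0,
  that is AB = A + B - 1.\<close>

lemma corr_power2_product:
  assumes xy: "x \<in> K0" "y \<in> K0" and z: "z \<in> K0 - {x, y}"
  shows "(corr x z)\<^sup>2 * (corr y z)\<^sup>2 =
    (if (corr x y)\<^sup>2 = real n then real n * ((corr x z)\<^sup>2 + (corr y z)\<^sup>2) - (real n)\<^sup>2
     else real n * (corr x z)\<^sup>2)"
proof -
  have n: "real n \<noteq> 0" "(real n)\<^sup>2 \<noteq> real n"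
    using n_ge_2 by (simp_all add: power2_eq_square)
  have len: "length x = n" "length y = n" "length z = n"
    using assms by (simp_all add: K0_length)
  have xz: "if vadd x z \<in> R then corr x z = 0 else (corr x z)\<^sup>2 = real n"
    and yz: "if vadd y z \<in> R then corr y z = 0 else (corr y z)\<^sup>2 = real n"
    using corr_K0 assms by auto
  have yx: "vadd y x = vadd x y" "vadd z x = vadd x z" "vadd z y = vadd y z"
    using vadd_comm len by metis+
  show ?thesis
  proof (cases "vadd x y \<in> R")
    case True
    \<comment> \<open>The case \<open>x = y\<close> belongs here too: then \<open>corr x y\<close>
      is n, and n^2 differs from n.\<close>
    have c: "(corr x y)\<^sup>2 \<noteq> real n"
    proof (cases "x = y")
      case True
      then show ?thesis using n len by (simp add: corr_self)
    next
      case False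
      then show ?thesis using corr_K0[OF xy] True n by simp
    qed
    have "vadd x z \<in> R \<longleftrightarrow> vadd y z \<in> R"
      using add_in_R_trans[OF len] add_in_R_trans[OF len(2,1,3)] True unfolding yx by blast
    then show ?thesis using xz yz c by (cases "vadd x z \<in> R") simp_all
  next
    case False
    then have "x \<noteq> y" using vadd_self[OF len(1)] R_zero by auto
    then have c: "(corr x y)\<^sup>2 = real n" using corr_K0[OF xy] False by simp
    have "vadd x z \<notin> R \<or> vadd y z \<notin> R"
      using add_in_R_trans[OF len(3,1,2)] False unfolding yx by blast
    then have "(corr x z)\<^sup>2 = real n \<or> (corr y z)\<^sup>2 = real n"
      using xz yz by presburger
    then show ?thesis
      unfolding c by (elim disjE) (simp_all add: power2_eq_square[of "real n"] distrib_left)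
  qed
qed

text \<open>Whether \<open>x = y\<close> can be read off from \<open>corr x y\<close>, since the
  value n occurs only for equal words.\<close>

lemma sum_endpoints:
  assumes "x \<in> K0" "y \<in> K0" "x' \<in> K0" "y' \<in> K0" and xy: "corr x y = corr x' y'"
  shows "(\<Sum>z\<in>{x, y}. g (corr x z) (corr y z)) = (\<Sum>z\<in>{x', y'}. g (corr x' z) (corr y' z) :: real)"
proof -
  have sum: "(\<Sum>z\<in>{x, y}. g (corr x z) (corr y z)) = (if corr x y = real n then g (real n) (real n)
      else g (real n) (corr x y) + g (corr x y) (real n))" if "x \<in> K0" "y \<in> K0" for x y
  proof -
    have len: "length x = n" "length y = n" using that by (simp_all add: K0_length)
    then have "corr y x = corr x y" "corr x x = real n" "corr y y = real n"
      by (simp_all add: corr_comm[of y x] corr_self)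
    moreover have "corr x y = real n \<longleftrightarrow> x = y"
      using corr_eq_length[of x y] len by simp
    ultimately show ?thesis by (cases "x = y") simp_all
  qed
  show ?thesis unfolding sum[OF assms(1,2)] sum[OF assms(3,4)] xy ..
qed

lemma sum_K0_split:
  assumes "x \<in> K0" "y \<in> K0"
  shows "(\<Sum>z\<in>K0. f z) = (\<Sum>z\<in>K0 - {x, y}. f z) + (\<Sum>z\<in>{x, y}. f z :: real)"
  using assms by (intro sum.subset_diff finite_K0) auto

text \<open>Leaving out \<open>x\<close> and \<open>y\<close> restricts both correlations to the
  values 0 and plus or minus sqrt n.\<close>

definition moment :: "word \<Rightarrow> word \<Rightarrow> nat \<Rightarrow> nat \<Rightarrow> real" where
  "moment x y a b = (\<Sum>z\<in>K0 - {x, y}. corr x z ^ a * corr y z ^ b)"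

lemma moment_2_2:
  assumes "x \<in> K0" "y \<in> K0"
  shows "moment x y 2 2 = (if (corr x y)\<^sup>2 = real n
    then real n * (moment x y 2 0 + moment x y 0 2) - (real n)\<^sup>2 * moment x y 0 0
    else real n * moment x y 2 0)"
proof -
  have "moment x y 2 2 = (\<Sum>z\<in>K0 - {x, y}. if (corr x y)\<^sup>2 = real n
      then real n * ((corr x z)\<^sup>2 + (corr y z)\<^sup>2) - (real n)\<^sup>2 else real n * (corr x z)\<^sup>2)"
    unfolding moment_def by (intro sum.cong refl corr_power2_product assms)
  then show ?thesis
    by (cases "(corr x y)\<^sup>2 = real n")
      (simp_all add: moment_def sum_subtractf sum.distrib flip: sum_distrib_left)
qed

text \<open>Up to total degree 3 the endpoint terms are subtracted from
  \<open>sum_K0_moment\<close>; the exponents 2, 2 reduce to lower moments by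
  \<open>moment_2_2\<close>.\<close>

lemma moment_eq:
  assumes "x \<in> K0" "y \<in> K0" "x' \<in> K0" "y' \<in> K0" "corr x y = corr x' y'" and ab: "a \<le> 2" "b \<le> 2"
  shows "moment x y a b = moment x' y' a b"
proof -
  have *: "moment x y a b = moment x' y' a b" if "a + b \<le> 3" "a \<le> 2" "b \<le> 2" for a b
  proof -
    have "(\<Sum>z\<in>K0. corr x z ^ a * corr y z ^ b) = (\<Sum>z\<in>K0. corr x' z ^ a * corr y' z ^ b)"
      unfolding sum_K0_moment[OF assms(1,2) that] sum_K0_moment[OF assms(3,4) that] assms(5) ..
    then show ?thesis
      using sum_endpoints[OF assms(1-5), of "\<lambda>u v. u ^ a * v ^ b"]
        sum_K0_split[OF assms(1,2), of "\<lambda>z. corr x z ^ a * corr y z ^ b"]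
        sum_K0_split[OF assms(3,4), of "\<lambda>z. corr x' z ^ a * corr y' z ^ b"]
      unfolding moment_def by linarith
  qed
  show ?thesis
  proof (cases "a + b \<le> 3")
    case True
    then show ?thesis using * ab by blast
  next
    case False
    then have "a = 2" "b = 2" using ab by auto
    then show ?thesis using assms by (simp add: moment_2_2 *)
  qed
qed

text \<open>Lagrange interpolation on the values \<open>0, \<plusminus>\<surd>n\<close> of \<open>corr\<close>.\<close>

definition indicator_coeff :: "real \<Rightarrow> nat \<Rightarrow> real" where
  "indicator_coeff t k =
     (if t = 0 then of_bool (k = 0) - of_bool (k = 2) / real n
      else if t\<^sup>2 = real n then (of_bool (k = 1) * t + of_bool (k = 2)) / (2 * real n)
      else 0)"

lemma of_bool_eq_indicator_poly:
  assumes u: "u = 0 \<or> u\<^sup>2 = real n"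
  shows "of_bool (u = t) = (\<Sum>k\<le>2. indicator_coeff t k * u ^ k)"
proof -
  have n: "real n \<noteq> 0" using n_ge_2 by simp
  have expand: "(\<Sum>k\<le>2. indicator_coeff t k * u ^ k) =
      indicator_coeff t 0 + indicator_coeff t 1 * u + indicator_coeff t 2 * u\<^sup>2"
    by (simp add: numeral_2_eq_2)
  consider "t = 0" | "t \<noteq> 0" "t\<^sup>2 = real n" | "t \<noteq> 0" "t\<^sup>2 \<noteq> real n" by blast
  then show ?thesis
  proof cases
    case 1
    then show ?thesis using u n unfolding expand by (cases "u = 0") (auto simp: indicator_coeff_def)
  next
    \<comment> \<open>The polynomial is u(u + t)/(2n), with zeros 0 and -t and the value 1 at
      t.\<close>
    case 2
    have "u = 0 \<or> u = t \<or> u = - t"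
      using u 2(2) by (metis power2_eq_iff)
    moreover have "t * t = real n" using 2(2) by (simp add: power2_eq_square)
    ultimately show ?thesis
      using 2 n unfolding expand by (auto simp: indicator_coeff_def power2_eq_square)
  next
    \<comment> \<open>Here \<open>t\<close> is not among the three possible values, so both sides
      are 0.\<close>
    case 3
    then show ?thesis using u unfolding expand by (auto simp: indicator_coeff_def)
  qed
qed

text \<open>The indicator of each of the two conditions is a quadratic polynomial in a correlation.
  The count is thus a combination of moments with exponents at most 2, plus the endpoint
  terms.\<close>

lemma card_K0_corr_eq:
  assumes "x \<in> K0" "y \<in> K0" "x' \<in> K0" "y' \<in> K0" "corr x y = corr x' y'"
  shows "card {z \<in> K0. corr x z = t \<and> corr y z = u} = card {z \<in> K0. corr x' z = t \<and> corr y' z = u}"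
proof -
  have expand: "real (card {z \<in> K0. corr x z = t \<and> corr y z = u}) =
      (\<Sum>a\<le>2. \<Sum>b\<le>2. indicator_coeff t a * indicator_coeff u b * moment x y a b)
      + (\<Sum>z\<in>{x, y}. of_bool (corr x z = t) * of_bool (corr y z = u))"
    if xy: "x \<in> K0" "y \<in> K0" for x y
  proof -
    have "real (card {z \<in> K0. corr x z = t \<and> corr y z = u}) =
        (\<Sum>z\<in>K0. of_bool (corr x z = t) * of_bool (corr y z = u))"
      by (simp add: finite_K0 Int_def flip: of_bool_conj)
    also have "\<dots> = (\<Sum>z\<in>K0 - {x, y}. of_bool (corr x z = t) * of_bool (corr y z = u))
        + (\<Sum>z\<in>{x, y}. of_bool (corr x z = t) * of_bool (corr y z = u))"
      by (rule sum_K0_split[OF xy])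
    also have "(\<Sum>z\<in>K0 - {x, y}. of_bool (corr x z = t) * of_bool (corr y z = u)) =
        (\<Sum>z\<in>K0 - {x, y}. \<Sum>a\<le>2. \<Sum>b\<le>2.
          indicator_coeff t a * indicator_coeff u b * (corr x z ^ a * corr y z ^ b))"
    proof (intro sum.cong refl)
      fix z assume z: "z \<in> K0 - {x, y}"
      then have "corr x z = 0 \<or> (corr x z)\<^sup>2 = real n" "corr y z = 0 \<or> (corr y z)\<^sup>2 = real n"
        using xy corr_K0_cases[of x z] corr_K0_cases[of y z] by auto
      from this[THEN of_bool_eq_indicator_poly]
      show "of_bool (corr x z = t) * of_bool (corr y z = u) = (\<Sum>a\<le>2. \<Sum>b\<le>2.
          indicator_coeff t a * indicator_coeff u b * (corr x z ^ a * corr y z ^ b))"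
        by (simp only: sum_product) (simp only: mult_ac)
    qed
    also have "\<dots> = (\<Sum>a\<le>2. \<Sum>b\<le>2. indicator_coeff t a * indicator_coeff u b * moment x y a b)"
      unfolding moment_def sum_distrib_left
      by (subst sum.swap, rule sum.cong[OF refl], rule sum.swap)
    finally show ?thesis .
  qed
  have "(\<Sum>a\<le>2. \<Sum>b\<le>2. indicator_coeff t a * indicator_coeff u b * moment x y a b) =
      (\<Sum>a\<le>2. \<Sum>b\<le>2. indicator_coeff t a * indicator_coeff u b * moment x' y' a b)"
    by (intro sum.cong refl) (simp add: moment_eq[OF assms])
  moreover note sum_endpoints[OF assms, of "\<lambda>v w. of_bool (v = t) * of_bool (w = u)"]
  ultimately have "real (card {z \<in> K0. corr x z = t \<and> corr y z = u}) =
      real (card {z \<in> K0. corr x' z = t \<and> corr y' z = u})"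
    unfolding expand[OF assms(1,2)] expand[OF assms(3,4)] by (rule arg_cong2)
  then show ?thesis by (rule of_nat_eq_iff[THEN iffD1])
qed

lemma card_K0_hamming_eq:
  assumes "x \<in> K0" "y \<in> K0" "x' \<in> K0" "y' \<in> K0" "hamming_dist x y = hamming_dist x' y'"
  shows "card {z \<in> K0. hamming_dist x z = j \<and> hamming_dist y z = k} =
    card {z \<in> K0. hamming_dist x' z = j \<and> hamming_dist y' z = k}"
proof -
  have *: "hamming_dist w z = i \<longleftrightarrow> corr w z = real n - 2 * real i" if "w \<in> K0" for w z i
    using that by (auto simp: corr_hamming K0_length)
  have "corr x y = corr x' y'" using assms by (simp add: corr_hamming K0_length)
  then show ?thesis
    unfolding *[OF assms(1)] *[OF assms(2)] *[OF assms(3)] *[OF assms(4)]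
    by (rule card_K0_corr_eq[OF assms(1-4)])
qed

end

section \<open>Transfer to words with deleted positions\<close>

text \<open>Filtering a list of pairs makes the deletion of a position a matter of appending lists,
  without reindexing.\<close>

lemma hamming_dist_conv_filter:
  assumes "length x = length y"
  shows "hamming_dist x y = length (filter (\<lambda>(a, b). a \<noteq> b) (zip x y))"
  unfolding hamming_dist_def length_filter_conv_card using assms
  by (intro arg_cong[where f=card]) auto

lemma length_delete_pos: "p < length x \<Longrightarrow> length (delete_pos p x) = length x - 1"
  by (simp add: delete_pos_def)

lemma nth_delete_pos:
  "p < length x \<Longrightarrow> i < length x - 1 \<Longrightarrow> delete_pos p x ! i = x ! (if i < p then i else Suc i)"
  by (auto simp: delete_pos_def nth_append)

lemma hamming_dist_delete_pos:
  assumes "length x = length y" "p < length x" "x ! p = y ! p"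
  shows "hamming_dist (delete_pos p x) (delete_pos p y) = hamming_dist x y"
proof -
  have "zip x y = take p (zip x y) @ (x ! p, y ! p) # drop (Suc p) (zip x y)"
    using id_take_nth_drop[of p "zip x y"] assms by simp
  then have "filter (\<lambda>(a, b). a \<noteq> b) (zip x y) =
      filter (\<lambda>(a, b). a \<noteq> b) (take p (zip x y) @ drop (Suc p) (zip x y))"
    using assms(3) by (smt (verit) case_prod_conv filter.simps(2) filter_append)
  also have "take p (zip x y) @ drop (Suc p) (zip x y) = zip (delete_pos p x) (delete_pos p y)"
    using assms by (simp add: delete_pos_def take_zip drop_zip zip_append)
  finally show ?thesis
    using assms by (simp add: hamming_dist_conv_filter length_delete_pos)
qed

text \<open>For a finite nonempty code of constant length, \<open>regular\<close> supplies the
  intersection numbers; the other axioms follow from properties of the distance.\<close>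

lemma association_scheme_hamming_rel:
  assumes "finite X" "X \<noteq> {}" and len: "\<And>x. x \<in> X \<Longrightarrow> length x = N"
    and regular: "\<And>x y x' y' j k. \<lbrakk>x \<in> X; y \<in> X; x' \<in> X; y' \<in> X; hamming_dist x y = hamming_dist x' y'\<rbrakk> \<Longrightarrow>
      card {z \<in> X. hamming_dist x z = j \<and> hamming_dist y z = k} =
      card {z \<in> X. hamming_dist x' z = j \<and> hamming_dist y' z = k}"
  shows "association_scheme X (distances X) (hamming_rel X)"
  unfolding association_scheme_def
proof (intro conjI ballI)
  show "(\<Union>i\<in>distances X. hamming_rel X i) = X \<times> X"
    by (auto simp: distances_def hamming_rel_def)
  show "disjoint_family_on (hamming_rel X) (distances X)"
    by (auto simp: disjoint_family_on_def hamming_rel_def)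
  show "hamming_rel X i \<noteq> {}" if "i \<in> distances X" for i
    using that by (auto simp: distances_def hamming_rel_def)
  show "\<exists>j\<in>distances X. Id_on X = hamming_rel X j"
  proof
    show "Id_on X = hamming_rel X 0"
      by (auto simp: hamming_rel_def len hamming_dist_eq_0)
    show "0 \<in> distances X"
    proof -
      obtain x where "x \<in> X" using \<open>X \<noteq> {}\<close> by blast
      moreover have "0 = hamming_dist x x" by (simp add: hamming_dist_def)
      ultimately show ?thesis unfolding distances_def by blast
    qed
  qed
  show "\<exists>j\<in>distances X. (hamming_rel X i)\<inverse> = hamming_rel X j" if "i \<in> distances X" for i
    by (rule bexI[OF _ that]) (auto simp: hamming_rel_def hamming_dist_comm len)
  fix i j k
  assume "i \<in> distances X"
  \<comment> \<open>This fixed pair at distance \<open>i\<close> provides the value of the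
    intersection number.\<close>
  then obtain x y where xy: "x \<in> X" "y \<in> X" "hamming_dist x y = i"
    by (auto simp: distances_def)
  show "\<exists>\<delta>::nat. \<forall>(x, y)\<in>hamming_rel X i.
      finite {z \<in> X. (x, z) \<in> hamming_rel X j \<and> (y, z) \<in> hamming_rel X k} \<and>
      card {z \<in> X. (x, z) \<in> hamming_rel X j \<and> (y, z) \<in> hamming_rel X k} = \<delta>"
  proof (intro exI ballI, clarify, intro conjI)
    fix x' y' assume "(x', y') \<in> hamming_rel X i"
    then have x'y': "x' \<in> X" "y' \<in> X" "hamming_dist x' y' = i"
      by (auto simp: hamming_rel_def)
    show "finite {z \<in> X. (x', z) \<in> hamming_rel X j \<and> (y', z) \<in> hamming_rel X k}"
      using \<open>finite X\<close> by simp
    have "{z \<in> X. (x', z) \<in> hamming_rel X j \<and> (y', z) \<in> hamming_rel X k} =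
        {z \<in> X. hamming_dist x' z = j \<and> hamming_dist y' z = k}"
      using x'y' by (auto simp: hamming_rel_def)
    then show "card {z \<in> X. (x', z) \<in> hamming_rel X j \<and> (y', z) \<in> hamming_rel X k} =
        card {z \<in> X. hamming_dist x z = j \<and> hamming_dist y z = k}"
      using regular[OF x'y'(1,2) xy(1,2)] x'y'(3) xy(3) by simp
  qed
qed

section \<open>Kerdock codes satisfy the locale assumptions\<close>

definition affine :: "nat \<Rightarrow> bit \<Rightarrow> (nat \<Rightarrow> bit) \<Rightarrow> word" where
  "affine m c a = map (\<lambda>j. c + (\<Sum>i<m. a i * of_bool (bit j i))) [0..<2 ^ m]"

lemma RM1_iff_affine: "r \<in> RM1 m \<longleftrightarrow> (\<exists>c a. r = affine m c a)"
  unfolding RM1_def affine_def mem_Collect_eq by (simp only: simp_thms)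

lemma affine_in_RM1: "affine m c a \<in> RM1 m"
  unfolding RM1_iff_affine by blast

lemma length_affine: "length (affine m c a) = 2 ^ m"
  by (simp add: affine_def)

lemma nth_affine: "j < 2 ^ m \<Longrightarrow> affine m c a ! j = c + (\<Sum>i<m. a i * of_bool (bit j i))"
  unfolding affine_def by (simp only: nth_map nth_upt length_upt diff_zero add_0)

lemma affine_const: "affine m c (\<lambda>_. 0) = replicate (2 ^ m) c"
  unfolding affine_def by (simp only: mult_zero_left sum.neutral_const add_0_right map_replicate_const length_upt diff_zero)

lemma affine_cong: "(\<And>i. i < m \<Longrightarrow> a i = b i) \<Longrightarrow> affine m c a = affine m c b"
  by (simp add: affine_def)

lemma vadd_affine: "vadd (affine m c a) (affine m d b) = affine m (c + d) (\<lambda>i. a i + b i)"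
proof (rule nth_equalityI)
  fix j assume "j < length (vadd (affine m c a) (affine m d b))"
  then have j: "j < 2 ^ m" by (simp add: length_affine)
  then have "vadd (affine m c a) (affine m d b) ! j = affine m c a ! j + affine m d b ! j"
    by (intro nth_vadd) (simp_all add: length_affine)
  also have "\<dots> = affine m (c + d) (\<lambda>i. a i + b i) ! j"
    unfolding nth_affine[OF j] distrib_right sum.distrib by (simp only: add_ac)
  finally show "vadd (affine m c a) (affine m d b) ! j = affine m (c + d) (\<lambda>i. a i + b i) ! j" .
qed (simp add: length_affine)

lemma length_RM1: "r \<in> RM1 m \<Longrightarrow> length r = 2 ^ m"
  by (auto simp: RM1_iff_affine length_affine)

text \<open>A word is determined by its constant term and the set of indices below \<open>m\<close>
  with coefficient 1.\<close>

lemma card_RM1_le: "card (RM1 m) \<le> 2 * 2 ^ m"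
proof -
  let ?f = "\<lambda>(c, A). affine m c (\<lambda>i. of_bool (i \<in> A))"
  have sub: "RM1 m \<subseteq> ?f ` ({0, 1} \<times> Pow {..<m})"
  proof
    fix r assume "r \<in> RM1 m"
    then obtain c a where r: "r = affine m c a" unfolding RM1_iff_affine by blast
    have "a i = of_bool (i \<in> {i. i < m \<and> a i = 1})" if "i < m" for i
      using that by (cases "a i") auto
    then have "r = ?f (c, {i. i < m \<and> a i = 1})"
      unfolding r prod.case by (rule affine_cong)
    moreover have "(c, {i. i < m \<and> a i = 1}) \<in> {0, 1} \<times> Pow {..<m}"
      by auto
    ultimately show "r \<in> ?f ` ({0, 1} \<times> Pow {..<m})"
      by (rule image_eqI)
  qed
  have "card (RM1 m) \<le> card ({0, 1 :: bit} \<times> Pow {..<m})"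
    by (rule surj_card_le[OF _ sub]) simp
  then show ?thesis by (simp add: card_cartesian_product card_Pow)
qed

lemma first_order_RM1:
  assumes "1 \<le> m"
  shows "first_order (2 ^ m) (RM1 m)"
proof
  show "2 \<le> (2 :: nat) ^ m"
    using assms power_increasing[of 1 m "2 :: nat"] by simp
  show "length r = 2 ^ m" if "r \<in> RM1 m" for r
    using that by (rule length_RM1)
  show "replicate (2 ^ m) 0 \<in> RM1 m" "replicate (2 ^ m) 1 \<in> RM1 m"
    unfolding affine_const[symmetric] by (rule affine_in_RM1)+
  show "vadd r t \<in> RM1 m" if rt: "r \<in> RM1 m" "t \<in> RM1 m" for r t
  proof -
    obtain c a where r: "r = affine m c a" using rt(1) unfolding RM1_iff_affine by blast
    obtain d b where t: "t = affine m d b" using rt(2) unfolding RM1_iff_affine by blast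
    show ?thesis unfolding r t vadd_affine by (rule affine_in_RM1)
  qed
  show "\<exists>r\<in>RM1 m. r ! p \<noteq> r ! q" if pq: "p < 2 ^ m" "q < 2 ^ m" "p \<noteq> q" for p q
  proof -
    \<comment> \<open>The separating word is the coordinate function of a binary digit in which
      \<open>p\<close> and \<open>q\<close> differ; digits from \<open>m\<close> on vanish below
      2^m.\<close>
    obtain i where i: "bit p i \<noteq> bit q i"
      using pq(3) bit_eq_iff by blast
    have "i < m"
    proof (rule ccontr)
      assume "\<not> i < m"
      then have "\<not> bit p i" "\<not> bit q i"
        using pq by (metis bit_take_bit_iff take_bit_nat_eq_self_iff)+
      then show False using i by simp
    qed
    have nth: "affine m 0 (\<lambda>k. of_bool (k = i)) ! j = of_bool (bit j i)" if "j < 2 ^ m" for j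
    proof -
      have "(\<Sum>k<m. of_bool (k = i) * of_bool (bit j k)) =
          (\<Sum>k<m. if k = i then of_bool (bit j k) else (0 :: bit))"
        by (intro sum.cong) auto
      also have "\<dots> = of_bool (bit j i)"
        using \<open>i < m\<close> by simp
      finally show ?thesis unfolding nth_affine[OF that] add_0 .
    qed
    have "affine m 0 (\<lambda>k. of_bool (k = i)) ! p \<noteq> affine m 0 (\<lambda>k. of_bool (k = i)) ! q"
      unfolding nth[OF pq(1)] nth[OF pq(2)] using i by auto
    then show ?thesis using affine_in_RM1 by blast
  qed
  show "card (RM1 m) \<le> 2 * 2 ^ m" by (rule card_RM1_le)
qed

lemma kerdock_code_imp_kerdock:
  assumes m: "1 \<le> m" and K: "kerdock_code m K"
  shows "kerdock (2 ^ m) (RM1 m) K" "RM1 m \<subseteq> K"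
proof -
  interpret first_order "2 ^ m" "RM1 m" using m by (rule first_order_RM1)
  let ?n = "2 ^ m :: nat"
  obtain \<C> where len: "binary_code ?n K"
    and dist: "real (min_distance K) = (real ?n - sqrt (real ?n)) / 2"
    and K_eq: "K = RM1 m \<union> \<Union>\<C>" and fin: "finite \<C>" and card: "card \<C> = 2 ^ (m - 1) - 1"
    and \<C>: "\<And>A. A \<in> \<C> \<Longrightarrow> \<exists>u. length u = ?n \<and> A = coset u (RM1 m)" "RM1 m \<notin> \<C>"
    using K unfolding kerdock_code_def Let_def by blast
  show "RM1 m \<subseteq> K" using K_eq by blast
  \<comment> \<open>RM(1,m) is the coset of zero. Including it makes \<open>K\<close> a disjoint
    union of 2^(m-1) cosets treated alike.\<close>
  define \<D> where "\<D> = insert (RM1 m) \<C>"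
  have K_\<D>: "K = \<Union>\<D>" by (simp add: K_eq \<D>_def)
  have \<D>: "\<exists>u. length u = ?n \<and> A = coset u (RM1 m)" if "A \<in> \<D>" for A
  proof (cases "A = RM1 m")
    case True
    then show ?thesis using coset_zero length_replicate by metis
  next
    case False
    then show ?thesis using that \<C>(1) by (simp add: \<D>_def)
  qed
  have \<D>_eq: "A = coset x (RM1 m)" if "A \<in> \<D>" "x \<in> A" for A x
    using \<D>[OF that(1)] that(2) coset_eq by blast
  have Klen: "length x = ?n" if "x \<in> K" for x
    using len that by (auto simp: binary_code_def)
  have finK: "finite K"
    using finite_words by (rule finite_subset[rotated]) (auto simp: Klen)
  show "kerdock ?n (RM1 m) K"
  proof
    show "length x = ?n" if "x \<in> K" for x using that by (rule Klen)
    show "vadd x r \<in> K" if "x \<in> K" "r \<in> RM1 m" for x r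
    proof -
      obtain A where A: "A \<in> \<D>" "x \<in> A" using \<open>x \<in> K\<close> K_\<D> by blast
      have "vadd x r \<in> A" unfolding \<D>_eq[OF A] coset_conv_image using \<open>r \<in> RM1 m\<close> by blast
      then show ?thesis using A(1) K_\<D> by blast
    qed
    have "card K = (\<Sum>A\<in>\<D>. card A)"
      unfolding K_\<D>
    proof (rule card_Union_disjoint)
      show "pairwise disjnt \<D>"
        \<comment> \<open>Two cosets with a common word are both the coset of that word.\<close>
        unfolding pairwise_def disjnt_def using \<D>_eq by blast
      show "finite A" if "A \<in> \<D>" for A
        using that finK K_\<D> by (meson Union_upper finite_subset)
    qed
    also have "\<dots> = (\<Sum>A\<in>\<D>. 2 * ?n)"
      using \<D> card_coset by (intro sum.cong) fastforce+
    also have "\<dots> = ?n\<^sup>2"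
    proof -
      obtain k where k: "m = Suc k" using m by (cases m) auto
      have "card \<D> = 2 ^ k" using \<C>(2) fin card by (simp add: \<D>_def k)
      then show ?thesis by (simp add: k power2_eq_square)
    qed
    finally show "card K = ?n\<^sup>2" .
    show "corr x y \<le> sqrt (real ?n)" if "x \<in> K" "y \<in> K" "x \<noteq> y" for x y
    proof -
      have "{hamming_dist x y |x y. x \<in> K \<and> y \<in> K \<and> x \<noteq> y} \<subseteq> (\<lambda>(x, y). hamming_dist x y) ` (K \<times> K)"
        by auto
      then have "finite {hamming_dist x y |x y. x \<in> K \<and> y \<in> K \<and> x \<noteq> y}"
        using finK by (meson finite_SigmaI finite_imageI finite_subset)
      then have "min_distance K \<le> hamming_dist x y"
        unfolding min_distance_def using that by (intro Min_le) auto
      then have "(real ?n - sqrt (real ?n)) / 2 \<le> real (hamming_dist x y)"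
        using dist by linarith
      then show ?thesis by (simp add: corr_hamming Klen[OF that(1)] field_simps)
    qed
  qed
qed

theorem theorem2:
  fixes m n :: nat and K K'' :: "word set"
  assumes "m \<ge> 4" and "even m" and "n = 2 ^ m"
    and "kerdock_code m K"
    and "doubly_shortened n K K''"
  shows "association_scheme K'' (distances K'') (hamming_rel K'')"
proof -
  obtain p q' where p: "p < n" and q': "q' < n - 1" and K'': "K'' = shorten q' (shorten p K)"
    using assms(5) by (auto simp: doubly_shortened_def)
  \<comment> \<open>Deleting position \<open>p\<close> moves all later positions down by one;
    \<open>q\<close> undoes this shift.\<close>
  define q where "q = (if q' < p then q' else Suc q')"
  have "1 \<le> m" using assms(1) by simp
  note kerdock = kerdock_code_imp_kerdock[OF this assms(4), folded assms(3)]
  interpret kerdock n "RM1 m" K by (rule kerdock(1))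
  interpret shortened_kerdock n "RM1 m" K p q
    by unfold_locales (use p q' in \<open>auto simp: q_def\<close>)
  define \<phi> :: "word \<Rightarrow> word" where "\<phi> x = delete_pos q' (delete_pos p x)" for x
  have at_q: "delete_pos p x ! q' = x ! q" if "x \<in> K" for x
    using nth_delete_pos[of p x q'] that p q' by (simp add: K_length q_def)
  have image: "K'' = \<phi> ` K0"
    unfolding K'' shorten_def K0_def \<phi>_def by (auto simp: at_q image_iff)
  have dist: "hamming_dist (\<phi> x) (\<phi> y) = hamming_dist x y" if "x \<in> K0" "y \<in> K0" for x y
    using that p q' unfolding \<phi>_def K0_def
    by (simp add: hamming_dist_delete_pos length_delete_pos K_length at_q)
  have len: "length (\<phi> x) = n - 2" if "x \<in> K0" for x
    using that p q' by (simp add: \<phi>_def length_delete_pos K0_length)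
  \<comment> \<open>A map preserving distances is injective, as distance 0 means equality.\<close>
  have inj: "inj_on \<phi> K0"
    by (rule inj_onI) (metis K0_length dist hamming_dist_eq_0)
  have count: "card {z \<in> K''. hamming_dist (\<phi> x) z = j \<and> hamming_dist (\<phi> y) z = k} =
      card {z \<in> K0. hamming_dist x z = j \<and> hamming_dist y z = k}"
    if "x \<in> K0" "y \<in> K0" for x y j k
  proof -
    have "{z \<in> K''. hamming_dist (\<phi> x) z = j \<and> hamming_dist (\<phi> y) z = k} =
        \<phi> ` {z \<in> K0. hamming_dist x z = j \<and> hamming_dist y z = k}"
      unfolding image using that dist by auto
    then show ?thesis using inj by (simp add: card_image inj_on_subset)
  qed
  show ?thesis
  proof (rule association_scheme_hamming_rel)
    show "finite K''" by (simp add: image finite_K0)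
    \<comment> \<open>The zero word of RM(1,m) survives both shortenings.\<close>
    show "K'' \<noteq> {}"
      using kerdock(2) R_zero p q by (auto simp: image K0_def)
    show "length x = n - 2" if "x \<in> K''" for x using that len by (auto simp: image)
    fix x y x' y' j k
    assume "x \<in> K''" "y \<in> K''" "x' \<in> K''" "y' \<in> K''" "hamming_dist x y = hamming_dist x' y'"
    moreover from this obtain u v u' v' where "u \<in> K0" "v \<in> K0" "u' \<in> K0" "v' \<in> K0"
      "x = \<phi> u" "y = \<phi> v" "x' = \<phi> u'" "y' = \<phi> v'" unfolding image by blast
    ultimately show "card {z \<in> K''. hamming_dist x z = j \<and> hamming_dist y z = k} =
      card {z \<in> K''. hamming_dist x' z = j \<and> hamming_dist y' z = k}"
      by (simp add: count dist card_K0_hamming_eq[of u v u' v'])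
  qed
qed

end
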